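(* Let $A \subseteq \mathbb{R}$ be a large set and let $\mathcal{F}$ be a large partition of $A$ of cardinality continuum into $(s_0)$-sets such that $A$ is $(s)$-dense with respect to $\mathcal{F}$. Then $\mathcal{F}$ is not a Kuratowski partition, i.e. there is a subfamily $\mathcal{F}' \subseteq \mathcal{F}$ such that $\bigcup \mathcal{F}'$ is not an $(s)$-set.
   Context: $\mathbb{R}$ carries its usual topology. A set $A \subseteq \mathbb{R}$ is an $(s)$-set if for every perfect set $P \subseteq \mathbb{R}$ there is a perfect set $P' \subseteq P$ with $P' \subseteq A \cap P$ or $P' \subseteq P \setminus A$. A set $A$ is an $(s_0)$-set if for every perfect $P \subseteq \mathbb{R}$ there is a perfect $P' \subseteq P$ with $P' \cap A = \emptyset$. A set is large if it is not an $(s_0)$-set; a family $\mathcal{F}$ of sets is large if $\bigcup \mathcal{F}$ is large. Given a large set $A$ and a large partition $\mathcal{F}$ of $A$ into $(s_0)$-sets, $A$ is $(s)$-dense (with respect to $\mathcal{F}$) if for every perfect set $P \subseteq \mathbb{R}$ such that $A \cap P$ is large, the family $\{F \in \mathcal{F} \colon F \cap P \neq \emptyset\}$ is large. In this (Marczewski) setting, a partition $\mathcal{F}$ of $A$ is a Kuratowski partition if for every subfamily $\mathcal{F}' \subseteq \mathcal{F}$ the set $\bigcup \mathcal{F}'$ is an $(s)$-set (the $(s)$-sets playing the role of sets with the Baire property). *)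

theory Defs
  imports "HOL-Analysis.Analysis" "HOL-Library.Disjoint_Sets" "HOL-Library.Equipollence"
begin

(* Nonemptiness is part of "perfect": with {} admitted, every set would be an (s0)-set. *)
definition perfect_set :: "real set \<Rightarrow> bool" where
  "perfect_set P \<longleftrightarrow> P \<noteq> {} \<and> closed P \<and> (\<forall>x\<in>P. x islimpt P)"

definition s_set :: "real set \<Rightarrow> bool" where
  "s_set A \<longleftrightarrow> (\<forall>P. perfect_set P \<longrightarrow>
     (\<exists>P'. perfect_set P' \<and> P' \<subseteq> P \<and> (P' \<subseteq> A \<inter> P \<or> P' \<subseteq> P - A)))"

definition s0_set :: "real set \<Rightarrow> bool" where
  "s0_set A \<longleftrightarrow> (\<forall>P. perfect_set P \<longrightarrow>
     (\<exists>P'. perfect_set P' \<and> P' \<subseteq> P \<and> P' \<inter> A = {}))"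

definition large_set :: "real set \<Rightarrow> bool" where
  "large_set A \<longleftrightarrow> \<not> s0_set A"

definition large_family :: "real set set \<Rightarrow> bool" where
  "large_family \<F> \<longleftrightarrow> large_set (\<Union>\<F>)"

definition s_dense :: "real set \<Rightarrow> real set set \<Rightarrow> bool" where
  "s_dense A \<F> \<longleftrightarrow> (\<forall>P. perfect_set P \<longrightarrow> large_set (A \<inter> P) \<longrightarrow>
     large_family {F \<in> \<F>. F \<inter> P \<noteq> {}})"

definition kuratowski_partition :: "real set \<Rightarrow> real set set \<Rightarrow> bool" where
  "kuratowski_partition A \<F> \<longleftrightarrow>
     partition_on A \<F> \<and> (\<forall>\<F>'. \<F>' \<subseteq> \<F> \<longrightarrow> s_set (\<Union>\<F>'))"

end

theory Submission
  imports Defs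
begin

text \<open>
  Suppose all unions of subfamilies are \<open>(s)\<close>-sets; then \<open>A\<close>, being large, contains a perfect set.
  Label the members of the partition by distinct subsets of the naturals. In every perfect
  \<open>X \<subseteq> A\<close> some label bit takes both values on perfect subsets of \<open>X\<close>: otherwise every bit is
  constant on densely many perfect subsets, and a decreasing sequence of compact perfect sets
  yields in every perfect subset of \<open>X\<close> a point with one and the same label, although the member
  carrying that label is an \<open>(s\<^sub>0)\<close>-set. Splitting along a Cantor scheme produces a perfect
  set \<open>Q\<close> that meets each member in at most one point. The members that meet a Bernstein
  subset of \<open>Q\<close> have a union that cuts \<open>Q\<close> in exactly that Bernstein set, which is not an
  \<open>(s)\<close>-set.
\<close>

section \<open>Perfect sets of reals: shrinking, nested intersections, cardinality\<close>

lemma perfect_setD: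
  assumes "perfect_set P"
  shows "P \<noteq> {}" "closed P" "x \<in> P \<Longrightarrow> x islimpt P"
  using assms by (auto simp: perfect_set_def)

text \<open>Intersecting with an open ball keeps every point a limit point, and taking the closure
  restores closedness. The radius \<open>e/3\<close> bounds all distances by \<open>2*e/3\<close>,
  which leaves the strict inequality after closing.\<close>

lemma perfect_set_shrink:
  assumes P: "perfect_set P" and e: "e > 0"
  obtains P' where "perfect_set P'" "P' \<subseteq> P" "bounded P'"
    "\<And>x y. x \<in> P' \<Longrightarrow> y \<in> P' \<Longrightarrow> dist x y < e"
proof -
  obtain a where a: "a \<in> P" using perfect_setD(1)[OF P] by auto
  define P' where "P' = closure (P \<inter> ball a (e/3))"
  have sub: "P' \<subseteq> cball a (e/3)"
    unfolding P'_def by (rule closure_minimal) auto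
  have lim: "x islimpt P'" if "x \<in> P'" for x
  proof -
    have inner: "y islimpt P \<inter> ball a (e/3)" if "y \<in> P \<inter> ball a (e/3)" for y
    proof -
      have "y islimpt P" using perfect_setD(3)[OF P] that by auto
      moreover have "eventually (\<lambda>z. z \<in> ball a (e/3)) (at y)"
        using that by (intro eventually_at_in_open') auto
      ultimately show ?thesis by (rule islimpt_Int_eventually)
    qed
    have "x \<in> P \<inter> ball a (e/3) \<or> x islimpt P \<inter> ball a (e/3)"
      using that by (simp add: P'_def closure_def)
    then have "x islimpt P \<inter> ball a (e/3)" using inner by metis
    then show ?thesis
      unfolding P'_def by (rule islimpt_subset) (rule closure_subset)
  qed
  show thesis
  proof
    have "a \<in> P'" unfolding P'_def using a e closure_subset[of "P \<inter> ball a (e/3)"] by auto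
    then show "perfect_set P'" using lim unfolding perfect_set_def P'_def by auto
    show "P' \<subseteq> P" unfolding P'_def using perfect_setD(2)[OF P] by (intro closure_minimal) auto
    show "bounded P'" using sub bounded_cball bounded_subset by blast
    show "dist x y < e" if "x \<in> P'" "y \<in> P'" for x y
    proof -
      have "dist a x \<le> e/3" "dist a y \<le> e/3" using that sub by auto
      then show ?thesis using dist_triangle2[of x y a] e by (simp add: dist_commute)
    qed
  qed
qed

lemma perfect_set_decseq_Inter:
  assumes "\<And>n::nat. perfect_set (Y n)" "\<And>n. bounded (Y n)" "\<And>n. Y (Suc n) \<subseteq> Y n"
  shows "(\<Inter>n. Y n) \<noteq> {}"
proof (rule compact_nest)
  show "compact (Y n)" "Y n \<noteq> {}" for n
    using assms perfect_setD by (auto simp: compact_eq_bounded_closed)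
  show "Y n \<subseteq> Y m" if "m \<le> n" for m n
    using lift_Suc_antimono_le[of Y, OF assms(3) that] .
qed

lemma perfect_set_lepoll_reals:
  assumes "perfect_set P"
  shows "(UNIV::real set) \<lesssim> P"
proof (rule lepoll_perfect_set)
  show "completely_metrizable_space (euclidean::real topology) \<or>
      locally_compact_space (euclidean::real topology) \<and> Hausdorff_space (euclidean::real topology)"
    using completely_metrizable_space_euclidean by blast
  have "(euclidean::real topology) derived_set_of P = {x. x islimpt P}"
    unfolding derived_set_of_def islimpt_def by (rule Collect_cong) (simp, metis)
  then show "(euclidean::real topology) derived_set_of P = P"
    using perfect_setD(2,3)[OF assms] by (auto simp: closed_limpt)
  show "P \<noteq> {}" by (rule perfect_setD(1)[OF assms])
qed

section \<open>Bernstein sets by transfinite choice\<close>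

text \<open>A closed set is determined by the basic open sets that miss it, hence by a set of
  naturals. The extra bit allows two tasks per perfect set in the Bernstein construction.\<close>

lemma closed_sets_times_bool_lepoll_reals:
  "({T::real set. closed T} \<times> (UNIV::bool set)) \<lesssim> (UNIV::real set)"
proof -
  obtain B :: "nat \<Rightarrow> real set" where B: "\<And>S. open S \<Longrightarrow> \<exists>k. S = \<Union>{B n |n. n \<in> k}"
    by (rule univ_second_countable_sequence) (rule that)
  define c where "c T = {n. B n \<subseteq> - T}" for T
  have c: "\<Union>(B ` c T) = - T" if T: "closed T" for T
  proof -
    obtain k where "- T = \<Union>{B n |n. n \<in> k}" using B[of "- T"] T by blast
    then have k: "- T = \<Union>(B ` k)" by (simp add: Setcompr_eq_image)
    then have "k \<subseteq> c T" unfolding c_def by (metis UN_upper mem_Collect_eq subsetI)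
    then have "- T \<subseteq> \<Union>(B ` c T)" unfolding k by (intro UN_mono) auto
    moreover have "\<Union>(B ` c T) \<subseteq> - T" unfolding c_def by (rule UN_least) simp
    ultimately show ?thesis by (rule equalityI[rotated])
  qed
  \<comment> \<open>Shifting the code by \<open>Suc\<close> frees the number 0, which then stores
    the bit.\<close>
  define h where "h = (\<lambda>(T, b::bool). Suc ` c T \<union> (if b then {0} else {}))"
  have "inj_on h ({T. closed T} \<times> UNIV)"
  proof (rule inj_onI, clarsimp)
    fix T T' :: "real set" and b b' :: bool
    assume cl: "closed T" "closed T'" and eq: "h (T, b) = h (T', b')"
    have "b \<longleftrightarrow> 0 \<in> h (T, b)" for T b by (auto simp: h_def)
    then have "b = b'" using eq by metis
    have "c T = Suc -` h (T, b)" for T b by (auto simp: h_def)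
    then have "c T = c T'" using eq by metis
    then show "T = T' \<and> b = b'" using c cl \<open>b = b'\<close> by (metis double_complement)
  qed
  then have "({T::real set. closed T} \<times> (UNIV::bool set)) \<lesssim> (UNIV :: nat set set)"
    unfolding lepoll_def by blast
  also have "\<dots> \<lesssim> (UNIV::real set)"
    using nat_sets_eqpoll_reals eqpoll_imp_lepoll by blast
  finally show ?thesis .
qed

text \<open>Choose the values by transfinite recursion along a well-order of \<open>I\<close> of
  least order type: fewer than \<open>I\<close> many values precede stage \<open>i\<close>, so they
  cannot exhaust \<open>S i\<close>.\<close>

lemma distinct_representatives:
  fixes S :: "'i \<Rightarrow> 'a set"
  assumes "\<And>i. i \<in> I \<Longrightarrow> I \<lesssim> S i"
  obtains g where "inj_on g I" "\<And>i. i \<in> I \<Longrightarrow> g i \<in> S i"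
proof -
  define r where "r = card_of I"
  have r: "Card_order r" "Field r = I" unfolding r_def by (rule card_of_Card_order, rule Field_card_of)
  have wo: "Well_order r" using r(1) by (simp add: card_order_on_def)
  have "\<exists>g. \<forall>i. i \<in> I \<longrightarrow> g i \<in> S i \<and> g i \<notin> g ` underS r i"
  proof (rule dependent_wf_choice[of "r - Id"])
    show "wf (r - Id)" using wo by (simp add: well_order_on_def)
    \<comment> \<open>The recursion principle requires that the condition at \<open>i\<close>
      depends only on the values at strict predecessors.\<close>
    show "(i \<in> I \<longrightarrow> x \<in> S i \<and> x \<notin> f ` underS r i) \<longleftrightarrow>
          (i \<in> I \<longrightarrow> x \<in> S i \<and> x \<notin> g ` underS r i)"
      if "\<And>j. (j, i) \<in> r - Id \<Longrightarrow> f j = g j" for f g :: "'i \<Rightarrow> 'a" and i x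
    proof -
      have "f ` underS r i = g ` underS r i"
        using that by (intro image_cong) (auto simp: underS_def)
      then show ?thesis by simp
    qed
    show "\<exists>x. i \<in> I \<longrightarrow> x \<in> S i \<and> x \<notin> f ` underS r i" for i and f :: "'i \<Rightarrow> 'a"
    proof (cases "i \<in> I")
      case True
      have "(card_of (f ` underS r i), card_of (underS r i)) \<in> ordLeq" by (rule card_of_image)
      moreover have "(card_of (underS r i), r) \<in> ordLess"
        using card_of_underS[OF r(1)] r(2) True by simp
      moreover have "(r, card_of (S i)) \<in> ordLeq"
        using assms[OF True] card_of_ordLeq[of I "S i"] by (simp add: r_def lepoll_def)
      ultimately have "(card_of (f ` underS r i), card_of (S i)) \<in> ordLess"
        by (metis ordLeq_ordLess_trans ordLess_ordLeq_trans)
      then have "\<not> S i \<subseteq> f ` underS r i"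
        using card_of_mono1[of "S i"] not_ordLess_ordLeq by metis
      then show ?thesis by blast
    qed auto
  qed
  then obtain g where g: "\<And>i. i \<in> I \<Longrightarrow> g i \<in> S i \<and> g i \<notin> g ` underS r i" by blast
  have "inj_on g I"
  proof (rule inj_onI, rule ccontr)
    fix i j assume ij: "i \<in> I" "j \<in> I" "g i = g j" "i \<noteq> j"
    have "total_on I r" using wo r(2) by (simp add: well_order_on_def linear_order_on_def)
    then have "i \<in> underS r j \<or> j \<in> underS r i"
      using ij by (auto simp: total_on_def underS_def)
    then show False using g ij by (metis imageI)
  qed
  then show thesis using g that by blast
qed

text \<open>Two points are picked from each perfect set, all of them distinct. Those tagged
  \<open>True\<close> form \<open>B\<close>; those tagged \<open>False\<close> witness that no
  perfect set lies inside \<open>B\<close>.\<close>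

lemma bernstein_set:
  obtains B where "\<And>P. perfect_set P \<Longrightarrow> P \<inter> B \<noteq> {} \<and> P - B \<noteq> {}"
proof -
  let ?I = "{P. perfect_set P} \<times> (UNIV::bool set)"
  have "?I \<lesssim> fst i" if "i \<in> ?I" for i
  proof -
    have "?I \<lesssim> ({T::real set. closed T} \<times> (UNIV::bool set))"
      by (rule subset_imp_lepoll) (auto simp: perfect_set_def)
    also have "\<dots> \<lesssim> (UNIV::real set)" by (rule closed_sets_times_bool_lepoll_reals)
    also have "\<dots> \<lesssim> fst i" using that perfect_set_lepoll_reals by auto
    finally show ?thesis .
  qed
  then obtain g where g: "inj_on g ?I" "\<And>i. i \<in> ?I \<Longrightarrow> g i \<in> fst i"
    using distinct_representatives[of ?I fst] by metis
  show thesis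
  proof
    let ?B = "g ` ({P. perfect_set P} \<times> {True})"
    fix P assume P: "perfect_set P"
    have "g (P, True) \<in> P \<inter> ?B" using P g(2)[of "(P, True)"] by auto
    moreover have "g (P, False) \<in> P" using P g(2)[of "(P, False)"] by auto
    moreover have "g (P, False) \<notin> ?B"
    proof
      assume "g (P, False) \<in> ?B"
      then obtain P' where "perfect_set P'" "g (P, False) = g (P', True)" by auto
      then show False using inj_onD[OF g(1), of "(P, False)" "(P', True)"] P by auto
    qed
    ultimately show "P \<inter> ?B \<noteq> {} \<and> P - ?B \<noteq> {}" by blast
  qed
qed

section \<open>A Cantor scheme on which a function is injective\<close>

text \<open>A binary tree of perfect sets with shrinking diameters is built so that \<open>f\<close>
  never takes a common value on two siblings. Distinct points in the intersection of the levels lie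
  in different nodes of some level, where \<open>f\<close> tells them apart.\<close>

lemma perfect_set_inj_on:
  fixes f :: "real \<Rightarrow> 'b"
  assumes P: "perfect_set P"
    and split: "\<And>X. perfect_set X \<Longrightarrow> X \<subseteq> P \<Longrightarrow>
      \<exists>Y Z. perfect_set Y \<and> perfect_set Z \<and> Y \<subseteq> X \<and> Z \<subseteq> X \<and> (\<forall>y\<in>Y. \<forall>z\<in>Z. f y \<noteq> f z)"
  obtains Q where "perfect_set Q" "Q \<subseteq> P" "inj_on f Q"
proof -
  define small where "small n X \<longleftrightarrow> perfect_set X \<and> bounded X \<and> X \<subseteq> P \<and>
    (\<forall>x\<in>X. \<forall>y\<in>X. dist x y < inverse (real (Suc n)))" for n X
  have shrink: "\<exists>X'. small n X' \<and> X' \<subseteq> X" if X: "perfect_set X" "X \<subseteq> P" for n X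
  proof -
    have "0 < inverse (real (Suc n))" by simp
    from perfect_set_shrink[OF X(1) this] obtain X' where
      "perfect_set X'" "X' \<subseteq> X" "bounded X'"
      "\<And>x y. x \<in> X' \<Longrightarrow> y \<in> X' \<Longrightarrow> dist x y < inverse (real (Suc n))" by blast
    then show ?thesis unfolding small_def using X(2) by blast
  qed
  have "\<exists>W. (\<forall>b. small n (W b) \<and> W b \<subseteq> X) \<and> (\<forall>y\<in>W True. \<forall>z\<in>W False. f y \<noteq> f z)"
    if X: "perfect_set X" "X \<subseteq> P" for n X
  proof -
    obtain Y Z where YZ: "perfect_set Y" "perfect_set Z" "Y \<subseteq> X" "Z \<subseteq> X"
      "\<forall>y\<in>Y. \<forall>z\<in>Z. f y \<noteq> f z" using split[OF X] by blast
    obtain Y' where Y': "small n Y'" "Y' \<subseteq> Y" using shrink YZ X by (meson subset_trans)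
    obtain Z' where Z': "small n Z'" "Z' \<subseteq> Z" using shrink YZ X by (meson subset_trans)
    have "\<forall>y\<in>Y'. \<forall>z\<in>Z'. f y \<noteq> f z" using YZ(5) Y'(2) Z'(2) by (meson subsetD)
    then show ?thesis
      by (intro exI[of _ "\<lambda>b. if b then Y' else Z'"]) (use YZ Y' Z' in auto)
  qed
  \<comment> \<open>Moving the assumptions on \<open>X\<close> under the quantifier makes the choice
    of \<open>W\<close> a total function of \<open>n\<close> and \<open>X\<close>.\<close>
  then have "\<forall>n X. \<exists>W. perfect_set X \<and> X \<subseteq> P \<longrightarrow>
      (\<forall>b. small n (W b) \<and> W b \<subseteq> X) \<and> (\<forall>y\<in>W True. \<forall>z\<in>W False. f y \<noteq> f z)"
    by auto
  then obtain W where "\<forall>n X. perfect_set X \<and> X \<subseteq> P \<longrightarrow>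
      (\<forall>b. small n (W n X b) \<and> W n X b \<subseteq> X) \<and> (\<forall>y\<in>W n X True. \<forall>z\<in>W n X False. f y \<noteq> f z)"
    unfolding choice_iff by (rule exE)
  then have W: "small n (W n X b) \<and> W n X b \<subseteq> X"
    and sep: "y \<in> W n X True \<Longrightarrow> z \<in> W n X False \<Longrightarrow> f y \<noteq> f z"
    if "perfect_set X" "X \<subseteq> P" for n X b y z
    using that by auto
  obtain R where R: "small 0 R" using shrink[OF P order_refl] by blast
  \<comment> \<open>Nodes are addressed by bit lists with the newest bit at the head, so
    \<open>b # s\<close> is a child of \<open>s\<close>.\<close>
  define S where "S = rec_list R (\<lambda>b s X. W (Suc (length s)) X b)"
  have S_simps: "S [] = R" "S (b # s) = W (Suc (length s)) (S s) b" for b s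
    by (simp_all add: S_def)
  have S: "small (length s) (S s)" for s
  proof (induction s)
    case Nil
    then show ?case using R by (simp add: S_simps)
  next
    case (Cons b s)
    then have "perfect_set (S s)" "S s \<subseteq> P" by (auto simp: small_def)
    then show ?case using W by (simp add: S_simps)
  qed
  have S_perf: "perfect_set (S s)" "bounded (S s)" "S s \<subseteq> P" for s
    using S[of s] by (auto simp: small_def)
  have S_dist: "dist x y < inverse (real (Suc (length s)))" if "x \<in> S s" "y \<in> S s" for x y s
    using S[of s] that by (auto simp: small_def)
  have S_sub: "S (b # s) \<subseteq> S s" for b s
    using W S_perf by (simp add: S_simps)
  have S_sep1: "f y \<noteq> f z" if "y \<in> S (b # s)" "z \<in> S ((\<not> b) # s)" for b s y z
    using that sep[of "S s" _ "Suc (length s)"] S_perf[of s] by (cases b) (auto simp: S_simps, metis)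
  \<comment> \<open>Equal tails leave two siblings; otherwise the claim passes up to the parents,
    which contain the given points.\<close>
  have S_sep: "f y \<noteq> f z" if "length s = length t" "s \<noteq> t" "y \<in> S s" "z \<in> S t" for s t y z
    using that
  proof (induction s t rule: list_induct2)
    case (Cons b s c t)
    show ?case
    proof (cases "s = t")
      case True
      then have "c = (\<not> b)" using Cons.prems by auto
      then show ?thesis using True Cons.prems S_sep1 by blast
    next
      case False
      then show ?thesis using Cons S_sub by blast
    qed
  qed simp
  define L where "L n = (\<Union>s\<in>{s. length s = n}. S s)" for n
  have L_anti: "L (Suc n) \<subseteq> L n" for n
    unfolding L_def by (auto simp: length_Suc_conv) (use S_sub in blast)
  have L_mono: "L n \<subseteq> L m" if "m \<le> n" for m n
    using lift_Suc_antimono_le[of L, OF L_anti that] .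
  define Q where "Q = (\<Inter>n. L n)"
  \<comment> \<open>Below \<open>t\<close>, the branch that always turns \<open>False\<close> has a
    common point by compactness. Its \<open>n\<close>-th node lies on level
    \<open>n + length t\<close>, so the point belongs to every level.\<close>
  have meet: "\<exists>x. x \<in> Q \<and> x \<in> S t" for t
  proof -
    define Y where "Y k = S (replicate k False @ t)" for k
    have "(\<Inter>k. Y k) \<noteq> {}"
      by (rule perfect_set_decseq_Inter) (auto simp: Y_def S_perf intro: subsetD[OF S_sub])
    then obtain x where x: "\<And>k. x \<in> Y k" by blast
    have "x \<in> L n" for n
    proof -
      have "x \<in> L (n + length t)" using x[of n] unfolding L_def Y_def by force
      then show ?thesis using L_mono[of n "n + length t"] by auto
    qed
    then show ?thesis using x[of 0] by (auto simp: Q_def Y_def)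
  qed
  have "closed (L n)" for n
  proof -
    have "finite {s::bool list. length s = n}"
      using finite_lists_length_eq[of "UNIV::bool set" n] by simp
    then show ?thesis unfolding L_def using S_perf perfect_setD by (intro closed_UN) auto
  qed
  then have "closed Q" unfolding Q_def by blast
  moreover have "Q \<noteq> {}" using meet by blast
  moreover have "x islimpt Q" if x: "x \<in> Q" for x
    unfolding islimpt_approachable
  proof (intro allI impI)
    fix e :: real assume "e > 0"
    then obtain n where n: "inverse (real (Suc n)) < e" using reals_Archimedean by blast
    have "x \<in> L (Suc n)" using x by (auto simp: Q_def)
    then obtain b s where s: "length s = n" "x \<in> S (b # s)"
      unfolding L_def by (auto simp: length_Suc_conv)
    \<comment> \<open>The sibling of the node around \<open>x\<close> supplies a second point of
      \<open>Q\<close>; both lie in the small parent \<open>S s\<close>.\<close>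
    obtain z where z: "z \<in> Q" "z \<in> S ((\<not> b) # s)" using meet by blast
    have "z \<noteq> x" using S_sep1 s z by blast
    moreover have "dist z x < e"
      using S_dist[of z s x] s z S_sub n by force
    ultimately show "\<exists>z\<in>Q. z \<noteq> x \<and> dist z x < e" using z by blast
  qed
  ultimately have "perfect_set Q" by (auto simp: perfect_set_def)
  moreover have "Q \<subseteq> P"
  proof -
    have "Q \<subseteq> L 0" by (auto simp: Q_def)
    then show ?thesis using S_perf(3)[of "[]"] by (auto simp: L_def)
  qed
  moreover have "inj_on f Q"
  proof (rule inj_onI, rule ccontr)
    fix x y assume xy: "x \<in> Q" "y \<in> Q" "f x = f y" "x \<noteq> y"
    then obtain n where n: "inverse (real (Suc n)) < dist x y"
      using reals_Archimedean[of "dist x y"] by auto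
    have "x \<in> L n" "y \<in> L n" using xy by (auto simp: Q_def)
    then obtain s t where st: "length s = n" "length t = n" "x \<in> S s" "y \<in> S t"
      unfolding L_def by blast
    then have "s = t" using S_sep xy by metis
    then show False using S_dist st n by fastforce
  qed
  ultimately show thesis using that by blast
qed

section \<open>Splitting perfect sets by label bits\<close>

lemma perfect_set_split_label:
  fixes l :: "real \<Rightarrow> nat set"
  assumes X: "perfect_set X"
    and s: "\<And>n. s_set {x \<in> A. n \<in> l x}" and "X \<subseteq> A"
    and s0: "\<And>c. s0_set {x \<in> A. l x = c}"
  shows "\<exists>Y Z. perfect_set Y \<and> perfect_set Z \<and> Y \<subseteq> X \<and> Z \<subseteq> X \<and> (\<forall>y\<in>Y. \<forall>z\<in>Z. l y \<noteq> l z)"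
proof (rule ccontr)
  assume neg: "\<not> ?thesis"
  have dec: "\<exists>Y'. perfect_set Y' \<and> Y' \<subseteq> Y \<and> ((\<forall>x\<in>Y'. n \<in> l x) \<or> (\<forall>x\<in>Y'. n \<notin> l x))"
    if Y: "perfect_set Y" "Y \<subseteq> X" for Y n
  proof -
    obtain Y' where "perfect_set Y'" "Y' \<subseteq> Y"
      "Y' \<subseteq> {x \<in> A. n \<in> l x} \<inter> Y \<or> Y' \<subseteq> Y - {x \<in> A. n \<in> l x}"
      using s[of n, unfolded s_set_def, rule_format, OF Y(1)] by blast
    then show ?thesis using Y \<open>X \<subseteq> A\<close> by blast
  qed
  \<comment> \<open>The value \<open>b\<close> depends on \<open>n\<close> alone: if both values
    were constant on perfect subsets of \<open>X\<close>, these two subsets would contradict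
    \<open>neg\<close>.\<close>
  have "\<exists>b. \<forall>Y. perfect_set Y \<and> Y \<subseteq> X \<longrightarrow>
      (\<exists>Y'. perfect_set Y' \<and> Y' \<subseteq> Y \<and> (\<forall>x\<in>Y'. (n \<in> l x) = b))" for n
  proof (cases "\<exists>Y. perfect_set Y \<and> Y \<subseteq> X \<and> (\<forall>x\<in>Y. n \<in> l x)")
    case True
    then have "\<not> (\<exists>Z. perfect_set Z \<and> Z \<subseteq> X \<and> (\<forall>x\<in>Z. n \<notin> l x))"
      using neg by blast
    then show ?thesis using dec by (intro exI[of _ True]) (metis subset_trans)
  next
    case False
    then show ?thesis using dec by (intro exI[of _ False]) (metis subset_trans)
  qed
  then obtain b where b: "\<And>n Y. perfect_set Y \<Longrightarrow> Y \<subseteq> X \<Longrightarrow>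
      \<exists>Y'. perfect_set Y' \<and> Y' \<subseteq> Y \<and> (\<forall>x\<in>Y'. (n \<in> l x) = b n)"
    by metis
  have hit: "\<exists>x\<in>Y. l x = {n. b n}" if Y: "perfect_set Y" "Y \<subseteq> X" for Y
  proof -
    obtain Y0 where Y0: "perfect_set Y0" "Y0 \<subseteq> Y" "bounded Y0"
      using perfect_set_shrink[OF Y(1) zero_less_one] by metis
    \<comment> \<open>Each stage settles one more bit: \<open>T 0\<close> settles none, and
      \<open>T (Suc n)\<close> settles bit \<open>n\<close>. A common point has all bits prescribed
      by \<open>b\<close>.\<close>
    have "\<exists>T. \<forall>n. (perfect_set (T n) \<and> T n \<subseteq> Y0) \<and>
        (T (Suc n) \<subseteq> T n \<and> (\<forall>x\<in>T (Suc n). (n \<in> l x) = b n))"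
    proof (rule dependent_nat_choice)
      show "\<exists>T. perfect_set T \<and> T \<subseteq> Y0" using Y0 by blast
      show "\<exists>T'. (perfect_set T' \<and> T' \<subseteq> Y0) \<and> T' \<subseteq> T \<and> (\<forall>x\<in>T'. (n \<in> l x) = b n)"
        if "perfect_set T \<and> T \<subseteq> Y0" for T n
        using b[of T n] that Y Y0 by (meson subset_trans)
    qed
    then obtain T where T: "\<And>n. perfect_set (T n)" "\<And>n. T n \<subseteq> Y0" "\<And>n. T (Suc n) \<subseteq> T n"
      "\<And>n x. x \<in> T (Suc n) \<Longrightarrow> (n \<in> l x) = b n" by blast
    have "(\<Inter>n. T n) \<noteq> {}"
      using perfect_set_decseq_Inter T Y0(3) bounded_subset by metis
    then obtain x where x: "\<And>n. x \<in> T n" by blast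
    have "l x = {n. b n}" using T(4) x by auto
    then show ?thesis using x T(2) Y0(2) by blast
  qed
  \<comment> \<open>The points labelled \<open>{n. b n}\<close> form an \<open>(s_0)\<close>-set, so
    some perfect subset of \<open>X\<close> avoids them, against \<open>hit\<close>.\<close>
  obtain Y where "perfect_set Y" "Y \<subseteq> X" "Y \<inter> {x \<in> A. l x = {n. b n}} = {}"
    using s0[of "{n. b n}"] X unfolding s0_set_def by blast
  then show False using hit \<open>X \<subseteq> A\<close> by blast
qed

section \<open>From the partition to a union that is not an \<open>(s)\<close>-set\<close>

text \<open>Largeness gives a perfect set all of whose perfect subsets meet \<open>A\<close>, which
  rules out the second alternative for an \<open>(s)\<close>-set.\<close>

lemma s_set_large_contains_perfect:
  assumes "s_set A" "large_set A"
  obtains P where "perfect_set P" "P \<subseteq> A"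
  using assms unfolding s_set_def large_set_def s0_set_def by blast

lemma s0_set_empty: "s0_set {}"
  by (auto simp: s0_set_def)

theorem theorem1:
  fixes A :: "real set" and \<F> :: "real set set"
  assumes "large_set A"
    and "partition_on A \<F>"
    and "large_family \<F>"
    and "\<F> \<approx> (UNIV :: real set)"
    and "\<forall>F\<in>\<F>. s0_set F"
    and "s_dense A \<F>"
  shows "\<not> kuratowski_partition A \<F> \<and> (\<exists>\<F>'. \<F>' \<subseteq> \<F> \<and> \<not> s_set (\<Union>\<F>'))"
proof -
  have "\<exists>\<F>'. \<F>' \<subseteq> \<F> \<and> \<not> s_set (\<Union>\<F>')"
  proof (rule ccontr)
    assume "\<not> ?thesis"
    then have s: "s_set (\<Union>\<F>')" if "\<F>' \<subseteq> \<F>" for \<F>' using that by blast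
    have A: "\<Union>\<F> = A" using assms(2) by (simp add: partition_on_def)
    have same: "F = G" if "F \<in> \<F>" "G \<in> \<F>" "x \<in> F" "x \<in> G" for F G x
      using assms(2) that by (auto simp: partition_on_def disjoint_def)
    have "\<F> \<lesssim> (UNIV :: nat set set)"
      using assms(4) nat_sets_eqpoll_reals by (meson eqpoll_imp_lepoll eqpoll_sym eqpoll_trans)
    then obtain L :: "real set \<Rightarrow> nat set" where L: "inj_on L \<F>" unfolding lepoll_def by blast
    \<comment> \<open>On \<open>A\<close> this is a union over a single member, so points inherit
      the label of their member; outside \<open>A\<close> the value is \<open>{}\<close>.\<close>
    define l where "l x = \<Union>(L ` {F \<in> \<F>. x \<in> F})" for x
    have l: "l x = L F" if "F \<in> \<F>" "x \<in> F" for x F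
    proof -
      have "{F \<in> \<F>. x \<in> F} = {F}" using that same by blast
      then show ?thesis by (simp add: l_def)
    qed
    obtain P where P: "perfect_set P" "P \<subseteq> A"
      using s_set_large_contains_perfect s[of \<F>] A assms(1) by auto
    \<comment> \<open>Fixing one bit selects a subfamily of the partition.\<close>
    have bits: "s_set {x \<in> A. n \<in> l x}" for n
    proof -
      have "{x \<in> A. n \<in> l x} = \<Union>{F \<in> \<F>. n \<in> L F}" using l A by blast
      then show ?thesis using s[of "{F \<in> \<F>. n \<in> L F}"] by auto
    qed
    have fibres: "s0_set {x \<in> A. l x = c}" for c
    proof (cases "c \<in> L ` \<F>")
      case True
      then obtain F where F: "F \<in> \<F>" "c = L F" by blast
      have "{x \<in> A. l x = c} = F"
      proof
        show "F \<subseteq> {x \<in> A. l x = c}" using F l A by auto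
        show "{x \<in> A. l x = c} \<subseteq> F"
        proof clarify
          fix x assume x: "x \<in> A" "c = l x"
          then obtain G where G: "G \<in> \<F>" "x \<in> G" using A by blast
          then have "L G = L F" using l x F by simp
          then show "x \<in> F" using G F L by (auto dest: inj_onD)
        qed
      qed
      then show ?thesis using F assms(5) by auto
    next
      case False
      then have "{x \<in> A. l x = c} = {}" using l A by auto
      then show ?thesis using s0_set_empty by metis
    qed
    obtain Q where Q: "perfect_set Q" "Q \<subseteq> P" "inj_on l Q"
    proof (rule perfect_set_inj_on[OF P(1), of l])
      fix X assume "perfect_set X" "X \<subseteq> P"
      then show "\<exists>Y Z. perfect_set Y \<and> perfect_set Z \<and> Y \<subseteq> X \<and> Z \<subseteq> X \<and> (\<forall>y\<in>Y. \<forall>z\<in>Z. l y \<noteq> l z)"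
        using perfect_set_split_label[of X A l] bits fibres P(2) by blast
    qed blast
    obtain B where B: "\<And>P. perfect_set P \<Longrightarrow> P \<inter> B \<noteq> {} \<and> P - B \<noteq> {}"
      using bernstein_set by blast
    define \<F>' where "\<F>' = {F \<in> \<F>. F \<inter> (Q \<inter> B) \<noteq> {}}"
    have trace: "Q \<inter> \<Union>\<F>' = Q \<inter> B"
    proof
      have "Q \<subseteq> \<Union>\<F>" using Q(2) P(2) A by blast
      then show "Q \<inter> B \<subseteq> Q \<inter> \<Union>\<F>'" unfolding \<F>'_def by blast
      \<comment> \<open>A point \<open>x\<close> of \<open>Q\<close> and a point \<open>z\<close> of
        \<open>Q \<inter> B\<close> in the same member share a label, so injectivity of
        \<open>l\<close> on \<open>Q\<close> gives \<open>x = z\<close>.\<close>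
      show "Q \<inter> \<Union>\<F>' \<subseteq> Q \<inter> B"
      proof
        fix x assume "x \<in> Q \<inter> \<Union>\<F>'"
        then obtain F where x: "x \<in> Q" "F \<in> \<F>'" "x \<in> F" by blast
        then obtain z where "F \<in> \<F>" "z \<in> F" "z \<in> Q" "z \<in> B" by (auto simp: \<F>'_def)
        then show "x \<in> Q \<inter> B" using x l Q(3) by (metis IntI inj_onD)
      qed
    qed
    have "s_set (\<Union>\<F>')" by (rule s) (auto simp: \<F>'_def)
    then obtain P' where P': "perfect_set P'" "P' \<subseteq> Q"
      "P' \<subseteq> \<Union>\<F>' \<inter> Q \<or> P' \<subseteq> Q - \<Union>\<F>'"
      using Q(1) unfolding s_set_def by blast
    \<comment> \<open>By \<open>trace\<close>, \<open>P'\<close> is contained in \<open>B\<close> or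
      disjoint from \<open>B\<close>; \<open>B\<close> permits neither for a perfect set.\<close>
    then show False using B[OF P'(1)] trace by blast
  qed
  then show ?thesis by (auto simp: kuratowski_partition_def)
qed

end
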